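(* Let $(X,d)$ be a nonempty complete $b$-metric space with constant $s\ge 1$ and let $T\colon X\to X$ be an operator. Suppose that there exist a function $G\in\mathbb{G}_1\cup\mathbb{G}_2$ and a function $\varphi\in\Phi$ such that $T\in\mathbb{T}(X,G,\varphi)$. Then $T$ is a Picard-operator.
   Context: A pair $(X,d)$ is a $b$-metric space with constant $s\ge1$ if $d\colon X\times X\to[0,\infty)$ satisfies, for all $x,y,z\in X$: (i) $d(x,y)=0$ if and only if $x=y$; (ii) $d(x,y)=d(y,x)$; (iii) $d(x,y)\le s[d(x,z)+d(z,y)]$. (The functional $d$ need not be continuous.) Convergence $x_n\to x^*$ means $d(x_n,x^* )\to0$; Cauchy sequences and completeness are defined with respect to $d$ as for metric spaces. An operator $T\colon X\to X$ on a complete $b$-metric space is a Picard-operator if $T$ has a unique fixed point $x^*$ and $T^nx\to x^*$ for all $x\in X$. $\Phi$ is the set of functions $\varphi\colon(0,\infty)\to(0,\infty)$ such that (i) $\varphi$ is non-decreasing; (ii) $\lim_{n\to\infty}\varphi^n(t)=0$ for every $t\in(0,\infty)$, where $\varphi^n$ is the $n$-fold composition of $\varphi$ with itself. $\mathbb{G}_1$ is the set of functions $G\colon(0,\infty)\to(0,\infty)$ with $\inf G>0$. $\mathbb{G}_2$ is the set of functions $G\colon(0,\infty)\to(0,\infty)$ such that for every sequence $(\alpha_n)_{n\in\mathbb{N}}\subseteq(0,\infty)$: $\lim_{n\to\infty}G(\alpha_n)=0$ if and only if $\lim_{n\to\infty}\alpha_n=0$. For functions $G,\varphi\colon(0,\infty)\to(0,\infty)$,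 $\mathbb{T}(X,G,\varphi)$ is the set of operators $T\colon X\to X$ such that for all $x,y\in X$: $d(Tx,Ty)\ne0$ implies $G(d(Tx,Ty))\le\varphi(G(d(x,y)))$. *)

theory Defs
  imports "HOL-Analysis.Analysis" "HOL-Library.FuncSet"
begin

text \<open>
  The underlying set is an explicit carrier \<open>X\<close>; \<open>d\<close> and the operators \<open>T\<close> are total functions
  constrained only on \<open>X\<close>. Likewise, functions \<open>(0,\<infinity>) \<rightarrow> (0,\<infinity>)\<close> are elements of
  \<open>{0<..} \<rightarrow> {0<..}\<close>, and nothing is required of their values at nonpositive arguments.
\<close>

locale b_metric_space =
  fixes X :: "'a set" and d :: "'a \<Rightarrow> 'a \<Rightarrow> real" and s :: real
  assumes const_ge_one: "1 \<le> s"
    and nonneg: "\<lbrakk>x \<in> X; y \<in> X\<rbrakk> \<Longrightarrow> 0 \<le> d x y"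
    and zero_iff: "\<lbrakk>x \<in> X; y \<in> X\<rbrakk> \<Longrightarrow> d x y = 0 \<longleftrightarrow> x = y"
    and commute: "\<lbrakk>x \<in> X; y \<in> X\<rbrakk> \<Longrightarrow> d x y = d y x"
    and relaxed_triangle:
      "\<lbrakk>x \<in> X; y \<in> X; z \<in> X\<rbrakk> \<Longrightarrow> d x y \<le> s * (d x z + d z y)"

definition b_converges :: "('a \<Rightarrow> 'a \<Rightarrow> real) \<Rightarrow> (nat \<Rightarrow> 'a) \<Rightarrow> 'a \<Rightarrow> bool" where
  "b_converges d u l \<longleftrightarrow> (\<lambda>n. d (u n) l) \<longlonglongrightarrow> 0"

definition b_Cauchy :: "('a \<Rightarrow> 'a \<Rightarrow> real) \<Rightarrow> (nat \<Rightarrow> 'a) \<Rightarrow> bool" where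
  "b_Cauchy d u \<longleftrightarrow> (\<forall>\<epsilon>>0. \<exists>N. \<forall>m\<ge>N. \<forall>n\<ge>N. d (u m) (u n) < \<epsilon>)"

definition b_complete :: "'a set \<Rightarrow> ('a \<Rightarrow> 'a \<Rightarrow> real) \<Rightarrow> bool" where
  "b_complete X d \<longleftrightarrow>
    (\<forall>u. range u \<subseteq> X \<and> b_Cauchy d u \<longrightarrow> (\<exists>l\<in>X. b_converges d u l))"

definition Picard_operator :: "'a set \<Rightarrow> ('a \<Rightarrow> 'a \<Rightarrow> real) \<Rightarrow> ('a \<Rightarrow> 'a) \<Rightarrow> bool" where
  "Picard_operator X d T \<longleftrightarrow>
    T \<in> X \<rightarrow> X \<and>
    (\<exists>z\<in>X. T z = z \<and> (\<forall>y\<in>X. T y = y \<longrightarrow> y = z) \<and>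
      (\<forall>x\<in>X. b_converges d (\<lambda>n. (T ^^ n) x) z))"

definition Phi :: "(real \<Rightarrow> real) set" where
  "Phi = {\<phi> \<in> {0<..} \<rightarrow> {0<..}.
    mono_on {0<..} \<phi> \<and> (\<forall>t>0. (\<lambda>n. (\<phi> ^^ n) t) \<longlonglongrightarrow> 0)}"

definition GG1 :: "(real \<Rightarrow> real) set" where
  "GG1 = {G \<in> {0<..} \<rightarrow> {0<..}. 0 < (INF t\<in>{0<..}. G t)}"

definition GG2 :: "(real \<Rightarrow> real) set" where
  "GG2 = {G \<in> {0<..} \<rightarrow> {0<..}.
    \<forall>\<alpha> :: nat \<Rightarrow> real. (\<forall>n. 0 < \<alpha> n) \<longrightarrow>
      ((\<lambda>n. G (\<alpha> n)) \<longlonglongrightarrow> 0 \<longleftrightarrow> \<alpha> \<longlonglongrightarrow> 0)}"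

text \<open>
  In a b-metric space \<open>d (T x) (T y) \<noteq> 0\<close> forces \<open>x \<noteq> y\<close>, hence \<open>0 < d x y\<close>, so \<open>G\<close> and \<open>\<phi>\<close> are
  only ever evaluated on \<open>(0,\<infinity>)\<close> below.
\<close>

definition TT :: "'a set \<Rightarrow> ('a \<Rightarrow> 'a \<Rightarrow> real) \<Rightarrow> (real \<Rightarrow> real) \<Rightarrow> (real \<Rightarrow> real) \<Rightarrow> ('a \<Rightarrow> 'a) set" where
  "TT X d G \<phi> = {T \<in> X \<rightarrow> X.
    \<forall>x\<in>X. \<forall>y\<in>X. d (T x) (T y) \<noteq> 0 \<longrightarrow> G (d (T x) (T y)) \<le> \<phi> (G (d x y))}"

end

theory Submission
  imports Defs
begin

text \<open>
  Along two orbits the values \<open>G (d (T\<^sup>n x) (T\<^sup>n y))\<close> are dominated by \<open>\<phi>\<^sup>n (G (d x y))\<close>, which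
  tends to \<open>0\<close>. If \<open>inf G > 0\<close>, the orbits must therefore meet. If \<open>G \<in> \<G>\<^sub>2\<close>, they become
  arbitrarily close, and \<open>G < 1\<close> on some interval \<open>(0, \<epsilon>)\<close>, so the bound \<open>\<phi>\<^sup>k 1\<close>
  is uniform: some iterate \<open>T\<^sup>k\<close> shrinks all distances below \<open>\<epsilon>\<close> to less than \<open>\<epsilon> / (2 s)\<close>.
  Hence \<open>T\<^sup>k\<close> maps the \<open>\<epsilon>\<close>-ball around a late orbit point into itself, which
  traps the whole tail of the orbit and makes it Cauchy despite the constant \<open>s\<close>.
\<close>

section \<open>Quantitative forms of the two conditions on \<open>G\<close>\<close>

lemma GG1_lower_bound:
  assumes "G \<in> GG1"
  obtains g where "0 < g" "\<And>t. 0 < t \<Longrightarrow> g \<le> G t"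
proof
  have pos: "G t > 0" if "t > 0" for t
    using assms that by (auto simp: GG1_def Pi_iff)
  \<comment> \<open>A real \<open>INF\<close> is a lower bound only for a set bounded below;
    positivity of \<open>G\<close> supplies the bound 0.\<close>
  then have "bdd_below (G ` {0<..})"
    by (intro bdd_belowI[where m = 0]) (auto intro: less_imp_le)
  then show "(INF t\<in>{0<..}. G t) \<le> G t" if "0 < t" for t
    using that by (intro cINF_lower) auto
  show "0 < (INF t\<in>{0<..}. G t)"
    using assms by (simp add: GG1_def)
qed

lemma GG2_iff:
  assumes "G \<in> GG2" "\<And>n. 0 < \<alpha> n"
  shows "(\<lambda>n. G (\<alpha> n)) \<longlonglongrightarrow> 0 \<longleftrightarrow> \<alpha> \<longlonglongrightarrow> 0"
  using assms by (simp add: GG2_def)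

text \<open>Bridges \<epsilon>-\<delta> arguments and the sequential definition of
  \<open>GG2\<close>: points chosen with \<open>h t < 1 / (n + 1)\<close> form the sequence. It is
  applied with \<open>h\<close> the identity and with \<open>h = G\<close>, where \<open>P\<close>
  records the failure of the desired estimate.\<close>

lemma sequence_of_small_values:
  fixes h :: "real \<Rightarrow> real"
  assumes "\<And>\<delta>. 0 < \<delta> \<Longrightarrow> \<exists>t>0. h t < \<delta> \<and> P t" "\<And>t. 0 < t \<Longrightarrow> 0 < h t"
  obtains \<alpha> :: "nat \<Rightarrow> real" where "\<And>n. 0 < \<alpha> n" "\<And>n. P (\<alpha> n)" "(\<lambda>n. h (\<alpha> n)) \<longlonglongrightarrow> 0"
proof -
  have "\<exists>t>0. h t < 1 / real (Suc n) \<and> P t" for n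
    by (rule assms(1)) simp
  then obtain \<alpha> where \<alpha>: "\<And>n. 0 < \<alpha> n" "\<And>n. h (\<alpha> n) < 1 / real (Suc n)" "\<And>n. P (\<alpha> n)"
    by metis
  have "(\<lambda>n. h (\<alpha> n)) \<longlonglongrightarrow> 0"
  proof (rule tendsto_sandwich[OF _ _ tendsto_const])
    show "(\<lambda>n. 1 / real (Suc n)) \<longlonglongrightarrow> 0"
      using LIMSEQ_inverse_real_of_nat by (simp add: inverse_eq_divide)
  qed (use \<alpha> assms(2) in \<open>auto intro!: always_eventually less_imp_le\<close>)
  with \<alpha> that show thesis by blast
qed

text \<open>If no \<delta> worked, there would be arguments tending to 0 on which \<open>G\<close>
  stays at least \<epsilon>, against one direction of the equivalence in \<open>GG2\<close>. The
  next lemma uses the other direction in the same way.\<close>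

lemma GG2_small_values:
  assumes "G \<in> GG2" "0 < \<epsilon>"
  obtains \<delta> where "0 < \<delta>" "\<And>t. \<lbrakk>0 < t; t < \<delta>\<rbrakk> \<Longrightarrow> G t < \<epsilon>"
proof -
  have "\<exists>\<delta>>0. \<forall>t>0. t < \<delta> \<longrightarrow> G t < \<epsilon>"
  proof (rule ccontr)
    assume "\<not> ?thesis"
    then have *: "\<exists>t>0. t < \<delta> \<and> \<epsilon> \<le> G t" if "0 < \<delta>" for \<delta>
      using that by (meson not_less)
    obtain \<alpha> :: "nat \<Rightarrow> real" where \<alpha>: "\<And>n. 0 < \<alpha> n" "\<And>n. \<epsilon> \<le> G (\<alpha> n)" "\<alpha> \<longlonglongrightarrow> 0"
      using sequence_of_small_values[of "\<lambda>t. t" "\<lambda>t. \<epsilon> \<le> G t", OF *] by blast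
    then have "(\<lambda>n. G (\<alpha> n)) \<longlonglongrightarrow> 0"
      using GG2_iff assms(1) by blast
    then have "\<epsilon> \<le> 0"
      by (rule Lim_bounded2) (use \<alpha> in auto)
    with assms(2) show False by simp
  qed
  with that show thesis by blast
qed

lemma GG2_small_arguments:
  assumes "G \<in> GG2" "0 < \<epsilon>"
  obtains \<delta> where "0 < \<delta>" "\<And>t. \<lbrakk>0 < t; G t < \<delta>\<rbrakk> \<Longrightarrow> t < \<epsilon>"
proof -
  have "\<exists>\<delta>>0. \<forall>t>0. G t < \<delta> \<longrightarrow> t < \<epsilon>"
  proof (rule ccontr)
    assume "\<not> ?thesis"
    then have *: "\<exists>t>0. G t < \<delta> \<and> \<epsilon> \<le> t" if "0 < \<delta>" for \<delta>
      using that by (meson not_less)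
    have pos: "0 < G t" if "0 < t" for t
      using assms(1) that by (auto simp: GG2_def Pi_iff)
    obtain \<alpha> where \<alpha>: "\<And>n. 0 < \<alpha> n" "\<And>n. \<epsilon> \<le> \<alpha> n" "(\<lambda>n. G (\<alpha> n)) \<longlonglongrightarrow> 0"
      using sequence_of_small_values[of G "\<lambda>t. \<epsilon> \<le> t", OF * pos] by blast
    then have "\<alpha> \<longlonglongrightarrow> 0"
      using GG2_iff assms(1) by blast
    then have "\<epsilon> \<le> 0"
      by (rule Lim_bounded2) (use \<alpha> in auto)
    with assms(2) show False by simp
  qed
  with that show thesis by blast
qed

section \<open>Iterates of comparison functions\<close>

lemma Phi_pos: "\<phi> \<in> Phi \<Longrightarrow> 0 < t \<Longrightarrow> 0 < \<phi> t"
  by (auto simp: Phi_def Pi_iff)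

lemma Phi_mono: "\<lbrakk>\<phi> \<in> Phi; 0 < a; a \<le> b\<rbrakk> \<Longrightarrow> \<phi> a \<le> \<phi> b"
  by (auto simp: Phi_def intro: mono_onD)

lemma Phi_funpow_pos: "\<phi> \<in> Phi \<Longrightarrow> 0 < t \<Longrightarrow> 0 < (\<phi> ^^ n) t"
  by (induction n) (auto intro: Phi_pos)

lemma Phi_funpow_mono: "\<lbrakk>\<phi> \<in> Phi; 0 < a; a \<le> b\<rbrakk> \<Longrightarrow> (\<phi> ^^ n) a \<le> (\<phi> ^^ n) b"
  by (induction n) (auto intro: Phi_mono Phi_funpow_pos)

lemma Phi_eventually_less:
  assumes "\<phi> \<in> Phi" "0 < t" "0 < \<delta>"
  shows "\<forall>\<^sub>F n in sequentially. (\<phi> ^^ n) t < \<delta>"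
proof -
  have "(\<lambda>n. (\<phi> ^^ n) t) \<longlonglongrightarrow> 0"
    using assms by (auto simp: Phi_def)
  then show ?thesis
    using assms(3) by (rule order_tendstoD)
qed

text \<open>From \<open>t \<le> \<phi> t\<close>, monotonicity would keep every iterate at least
  \<open>t\<close>, so the iterates could not tend to 0.\<close>

lemma Phi_less:
  assumes "\<phi> \<in> Phi" "0 < t"
  shows "\<phi> t < t"
proof (rule ccontr)
  assume "\<not> \<phi> t < t"
  then have le: "t \<le> \<phi> t" by simp
  have "t \<le> (\<phi> ^^ n) t" for n
  proof (induction n)
    case (Suc n)
    then have "\<phi> t \<le> (\<phi> ^^ Suc n) t"
      using assms by (auto intro: Phi_mono)
    with le show ?case by linarith
  qed simp
  moreover obtain n where "(\<phi> ^^ n) t < t"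
    using eventually_happens[OF Phi_eventually_less[OF assms assms(2)]] by auto
  ultimately show False by (meson not_less)
qed

section \<open>Uniqueness of limits in a b-metric space\<close>

context b_metric_space
begin

text \<open>Since \<open>d\<close> may be discontinuous, no limit is taken inside \<open>d\<close>:
  the constant \<open>d l l'\<close> is bounded through \<open>u n\<close> by the relaxed triangle
  inequality, and that bound tends to 0.\<close>

lemma limit_unique:
  assumes "range u \<subseteq> X" "l \<in> X" "l' \<in> X" "b_converges d u l" "b_converges d u l'"
  shows "l = l'"
proof -
  have "(\<lambda>n. s * (d (u n) l + d (u n) l')) \<longlonglongrightarrow> s * (0 + 0)"
    using assms unfolding b_converges_def by (intro tendsto_intros)
  moreover have "d l l' \<le> s * (d (u n) l + d (u n) l')" for n
  proof -
    have "u n \<in> X" using assms(1) by auto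
    then show ?thesis
      using relaxed_triangle[of l l' "u n"] commute[of l "u n"] assms by simp
  qed
  ultimately have "d l l' \<le> 0"
    by (intro Lim_bounded2) auto
  then show ?thesis
    using nonneg[of l l'] zero_iff[of l l'] assms by auto
qed

end

section \<open>Orbits of a contraction, common to both cases for \<open>G\<close>\<close>

locale G_contraction = b_metric_space +
  fixes T :: "'a \<Rightarrow> 'a" and G \<phi> :: "real \<Rightarrow> real"
  assumes T_closed: "x \<in> X \<Longrightarrow> T x \<in> X"
    and G_pos: "0 < t \<Longrightarrow> 0 < G t"
    and phi: "\<phi> \<in> Phi"
    and contraction: "\<lbrakk>x \<in> X; y \<in> X; d (T x) (T y) \<noteq> 0\<rbrakk> \<Longrightarrow> G (d (T x) (T y)) \<le> \<phi> (G (d x y))"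
begin

lemma funpow_closed: "x \<in> X \<Longrightarrow> (T ^^ n) x \<in> X"
  by (induction n) (auto intro: T_closed)

lemma dist_pos: "\<lbrakk>x \<in> X; y \<in> X; x \<noteq> y\<rbrakk> \<Longrightarrow> 0 < d x y"
  using nonneg[of x y] zero_iff[of x y] by auto

text \<open>Once two orbits meet they stay together, so points that differ after \<open>n\<close>
  steps differ at every earlier step. Hence each intermediate distance is positive and the
  contraction condition can be iterated.\<close>

lemma funpow_contraction:
  assumes "x \<in> X" "y \<in> X" "(T ^^ n) x \<noteq> (T ^^ n) y"
  shows "G (d ((T ^^ n) x) ((T ^^ n) y)) \<le> (\<phi> ^^ n) (G (d x y))"
  using assms(3)
proof (induction n)
  case (Suc n)
  let ?x = "(T ^^ n) x" and ?y = "(T ^^ n) y"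
  have ne: "?x \<noteq> ?y" using Suc.prems by auto
  have "G (d (T ?x) (T ?y)) \<le> \<phi> (G (d ?x ?y))"
    using Suc.prems assms by (intro contraction) (auto simp: zero_iff funpow_closed T_closed)
  also have "\<dots> \<le> \<phi> ((\<phi> ^^ n) (G (d x y)))"
    using Suc.IH[OF ne] ne assms by (intro Phi_mono[OF phi] G_pos dist_pos funpow_closed)
  finally show ?case by simp
qed simp

lemma eventually_equal_or_small:
  assumes "x \<in> X" "y \<in> X" "0 < \<delta>"
  shows "\<forall>\<^sub>F n in sequentially. (T ^^ n) x = (T ^^ n) y \<or> G (d ((T ^^ n) x) ((T ^^ n) y)) < \<delta>"
proof (cases "x = y")
  case False
  then have "\<forall>\<^sub>F n in sequentially. (\<phi> ^^ n) (G (d x y)) < \<delta>"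
    using assms by (intro Phi_eventually_less phi G_pos dist_pos)
  then show ?thesis
    by eventually_elim (use funpow_contraction[OF assms(1,2)] in fastforce)
qed simp

text \<open>A fixed point has a constant orbit. Comparing it with another fixed point gives
  uniqueness, and with an arbitrary orbit gives convergence.\<close>

lemma Picard_operatorI:
  assumes "z \<in> X" "T z = z"
    and asymptotic: "\<And>x y. \<lbrakk>x \<in> X; y \<in> X\<rbrakk> \<Longrightarrow> (\<lambda>n. d ((T ^^ n) x) ((T ^^ n) y)) \<longlonglongrightarrow> 0"
  shows "Picard_operator X d T"
proof -
  have fix_pow: "(T ^^ n) y = y" if "T y = y" for n y
    using that by (induction n) auto
  have "y = z" if "y \<in> X" "T y = y" for y
    using asymptotic[of y z] that assms(1,2) zero_iff[of y z]
    by (simp add: fix_pow LIMSEQ_const_iff)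
  moreover have "b_converges d (\<lambda>n. (T ^^ n) x) z" if "x \<in> X" for x
    using asymptotic[of x z] that assms(1,2) by (simp add: fix_pow b_converges_def)
  ultimately show ?thesis
    unfolding Picard_operator_def using assms(1,2) T_closed by (blast intro: Pi_I)
qed

section \<open>The case of \<open>G\<close> with positive infimum\<close>

lemma Picard_operator_GG1:
  assumes "G \<in> GG1" "X \<noteq> {}"
  shows "Picard_operator X d T"
proof -
  obtain g where g: "0 < g" "\<And>t. 0 < t \<Longrightarrow> g \<le> G t"
    using GG1_lower_bound[OF assms(1)] by blast
  have meet: "\<forall>\<^sub>F n in sequentially. (T ^^ n) x = (T ^^ n) y" if "x \<in> X" "y \<in> X" for x y
    using eventually_equal_or_small[OF that g(1)]
  proof eventually_elim
    case (elim n)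
    then show ?case
      using g(2)[OF dist_pos[of "(T ^^ n) x" "(T ^^ n) y"]] that funpow_closed by fastforce
  qed
  obtain x where x: "x \<in> X" using assms(2) by auto
  \<comment> \<open>The orbit of \<open>T x\<close> is that of \<open>x\<close> shifted by one, so
    their meeting at time \<open>n\<close> makes \<open>(T ^^ n) x\<close> a fixed point.\<close>
  obtain n where n: "(T ^^ n) x = (T ^^ n) (T x)"
    using eventually_happens[OF meet[OF x T_closed[OF x]]] by auto
  show ?thesis
  proof (rule Picard_operatorI)
    show "(T ^^ n) x \<in> X" using x by (rule funpow_closed)
    show "T ((T ^^ n) x) = (T ^^ n) x" using n by (metis funpow_swap1)
    fix x y assume xy: "x \<in> X" "y \<in> X"
    show "(\<lambda>n. d ((T ^^ n) x) ((T ^^ n) y)) \<longlonglongrightarrow> 0"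
    proof (rule tendsto_eventually)
      show "\<forall>\<^sub>F n in sequentially. d ((T ^^ n) x) ((T ^^ n) y) = 0"
        using meet[OF xy] by eventually_elim (use xy funpow_closed zero_iff in auto)
    qed
  qed
qed

section \<open>The case of \<open>G\<close> in \<open>GG2\<close>\<close>

lemma GG2_asymptotic:
  assumes "G \<in> GG2" "x \<in> X" "y \<in> X"
  shows "(\<lambda>n. d ((T ^^ n) x) ((T ^^ n) y)) \<longlonglongrightarrow> 0"
proof (rule order_tendstoI)
  fix \<epsilon> :: real assume "0 < \<epsilon>"
  then obtain \<delta> where \<delta>: "0 < \<delta>" "\<And>t. \<lbrakk>0 < t; G t < \<delta>\<rbrakk> \<Longrightarrow> t < \<epsilon>"
    using GG2_small_arguments[OF assms(1)] by metis
  show "\<forall>\<^sub>F n in sequentially. d ((T ^^ n) x) ((T ^^ n) y) < \<epsilon>"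
    using eventually_equal_or_small[OF assms(2,3) \<delta>(1)]
  proof eventually_elim
    case (elim n)
    have "(T ^^ n) x \<in> X" "(T ^^ n) y \<in> X"
      using assms by (auto intro: funpow_closed)
    with elim show ?case
      using \<delta>(2) dist_pos zero_iff \<open>0 < \<epsilon>\<close> by metis
  qed
next
  fix a :: real assume "a < 0"
  then show "\<forall>\<^sub>F n in sequentially. a < d ((T ^^ n) x) ((T ^^ n) y)"
    using assms by (intro always_eventually allI) (meson funpow_closed nonneg less_le_trans)
qed

lemma GG2_uniform_contraction:
  assumes "G \<in> GG2" "0 < \<eta>" "\<And>t. \<lbrakk>0 < t; t < \<epsilon>\<rbrakk> \<Longrightarrow> G t < 1"
  obtains k where "0 < k"
    "\<And>x y. \<lbrakk>x \<in> X; y \<in> X; d x y < \<epsilon>\<rbrakk> \<Longrightarrow> d ((T ^^ k) x) ((T ^^ k) y) < \<eta>"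
proof -
  obtain \<delta> where \<delta>: "0 < \<delta>" "\<And>t. \<lbrakk>0 < t; G t < \<delta>\<rbrakk> \<Longrightarrow> t < \<eta>"
    using GG2_small_arguments[OF assms(1,2)] by metis
  \<comment> \<open>Positivity of \<open>k\<close> is recorded because the strong induction along an
    orbit will step back by \<open>k\<close>.\<close>
  have "\<forall>\<^sub>F k in sequentially. (\<phi> ^^ k) 1 < \<delta> \<and> 0 < k"
    using Phi_eventually_less[OF phi _ \<delta>(1)] eventually_gt_at_top by (intro eventually_conj) auto
  then obtain k where k: "(\<phi> ^^ k) 1 < \<delta>" "0 < k"
    using eventually_happens by (metis (no_types, lifting) sequentially_bot)
  have "d ((T ^^ k) x) ((T ^^ k) y) < \<eta>" if xy: "x \<in> X" "y \<in> X" "d x y < \<epsilon>" for x y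
  proof (cases "(T ^^ k) x = (T ^^ k) y")
    case True
    then show ?thesis
      using zero_iff xy funpow_closed assms(2) by metis
  next
    case False
    then have pos: "0 < d x y" using xy by (metis dist_pos)
    have "G (d ((T ^^ k) x) ((T ^^ k) y)) \<le> (\<phi> ^^ k) (G (d x y))"
      using xy False by (intro funpow_contraction)
    also have "\<dots> \<le> (\<phi> ^^ k) 1"
      using assms(3)[OF pos xy(3)] pos by (intro Phi_funpow_mono phi G_pos) auto
    finally show ?thesis
      using k(1) \<delta>(2) False xy dist_pos funpow_closed by force
  qed
  with k(2) that show thesis by blast
qed

lemma GG2_orbit_in_ball:
  assumes "G \<in> GG2" "x \<in> X" "0 < \<epsilon>" "\<And>t. \<lbrakk>0 < t; t < \<epsilon>\<rbrakk> \<Longrightarrow> G t < 1"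
  shows "\<exists>N. \<forall>j. d ((T ^^ (N + j)) x) ((T ^^ N) x) < \<epsilon>"
proof -
  \<comment> \<open>Two distances below \<eta>, joined by the relaxed triangle inequality, give a
    distance below \<epsilon>.\<close>
  define \<eta> where "\<eta> = \<epsilon> / (2 * s)"
  have "0 < \<eta>" "s * (\<eta> + \<eta>) = \<epsilon>" and le: "\<eta> \<le> \<epsilon>"
    using const_ge_one assms(3) by (auto simp: \<eta>_def field_simps)
  obtain k where k: "0 < k"
    "\<And>x y. \<lbrakk>x \<in> X; y \<in> X; d x y < \<epsilon>\<rbrakk> \<Longrightarrow> d ((T ^^ k) x) ((T ^^ k) y) < \<eta>"
    using GG2_uniform_contraction[OF assms(1) \<open>0 < \<eta>\<close> assms(4)] by metis
  \<comment> \<open>Only finitely many shifts \<open>j \<le> k\<close> are compared with the orbit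
    of \<open>x\<close>, so one index serves them all; they form the base of the induction
    below.\<close>
  have "\<forall>\<^sub>F n in sequentially. \<forall>j\<in>{..k}. d ((T ^^ n) ((T ^^ j) x)) ((T ^^ n) x) < \<eta>"
  proof (intro eventually_ball_finite ballI)
    fix j
    show "\<forall>\<^sub>F n in sequentially. d ((T ^^ n) ((T ^^ j) x)) ((T ^^ n) x) < \<eta>"
      using GG2_asymptotic[OF assms(1) funpow_closed[OF assms(2)] assms(2)] \<open>0 < \<eta>\<close>
      by (rule order_tendstoD)
  qed simp
  then obtain N where "\<forall>j\<le>k. d ((T ^^ N) ((T ^^ j) x)) ((T ^^ N) x) < \<eta>"
    using eventually_happens by (metis (no_types, lifting) atMost_iff sequentially_bot)
  then have N: "d ((T ^^ (N + j)) x) ((T ^^ N) x) < \<eta>" if "j \<le> k" for j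
    using that by (simp add: funpow_add)
  have "d ((T ^^ (N + j)) x) ((T ^^ N) x) < \<epsilon>" for j
  proof (induction j rule: less_induct)
    case (less j)
    show ?case
    proof (cases "j \<le> k")
      case True
      then show ?thesis using N le by fastforce
    next
      case False
      \<comment> \<open>\<open>?b\<close> lies \<open>k\<close> steps before the point in question
        and is in the ball by induction. Applying \<open>T ^^ k\<close> brings it within \<eta> of
        the image of the centre \<open>?a\<close>, which itself has moved by less than
        \<eta>.\<close>
      let ?a = "(T ^^ N) x" and ?b = "(T ^^ (N + (j - k))) x"
      have X: "?a \<in> X" "?b \<in> X" "(T ^^ k) ?a \<in> X" "(T ^^ k) ?b \<in> X"
        using assms(2) by (auto intro: funpow_closed)
      have eqs: "(T ^^ k) ?a = (T ^^ (N + k)) x" "(T ^^ k) ?b = (T ^^ (N + j)) x"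
        using False by (simp_all add: add.commute flip: funpow_add[THEN fun_cong, unfolded o_apply])
      have "d ?b ?a < \<epsilon>"
        using False k(1) by (intro less.IH) simp
      then have "d ((T ^^ k) ?b) ((T ^^ k) ?a) < \<eta>"
        using X by (intro k(2))
      moreover have "d ((T ^^ k) ?a) ?a < \<eta>"
        unfolding eqs by (rule N) simp
      ultimately have "s * (d ((T ^^ k) ?b) ((T ^^ k) ?a) + d ((T ^^ k) ?a) ?a) < s * (\<eta> + \<eta>)"
        using const_ge_one by (intro mult_strict_left_mono) auto
      then show ?thesis
        using relaxed_triangle[OF X(4) X(1) X(3)] \<open>s * (\<eta> + \<eta>) = \<epsilon>\<close> eqs(2) by simp
    qed
  qed
  then show ?thesis by blast
qed

lemma GG2_orbit_Cauchy:
  assumes "G \<in> GG2" "x \<in> X"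
  shows "b_Cauchy d (\<lambda>n. (T ^^ n) x)"
  unfolding b_Cauchy_def
proof (intro allI impI)
  fix \<epsilon> :: real assume "0 < \<epsilon>"
  obtain r where r: "0 < r" "\<And>t. \<lbrakk>0 < t; t < r\<rbrakk> \<Longrightarrow> G t < 1"
    using GG2_small_values[OF assms(1)] zero_less_one by metis
  \<comment> \<open>The bound \<open>r\<close> keeps \<open>G\<close> below 1 on the ball; the other
    bound lets two orbit points be compared through the centre \<open>(T ^^ N) x\<close>.\<close>
  define \<epsilon>' where "\<epsilon>' = min r (\<epsilon> / (2 * s))"
  have \<epsilon>': "0 < \<epsilon>'" "\<epsilon>' \<le> r" "s * (\<epsilon>' + \<epsilon>') \<le> \<epsilon>"
    using r(1) \<open>0 < \<epsilon>\<close> const_ge_one by (auto simp: \<epsilon>'_def min_def field_simps)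
  obtain N where N: "\<And>j. d ((T ^^ (N + j)) x) ((T ^^ N) x) < \<epsilon>'"
    using GG2_orbit_in_ball[OF assms \<epsilon>'(1)] r(2) \<epsilon>'(2) by (metis less_le_trans)
  have "d ((T ^^ m) x) ((T ^^ n) x) < \<epsilon>" if "N \<le> m" "N \<le> n" for m n
  proof -
    have X: "(T ^^ i) x \<in> X" for i using assms(2) by (rule funpow_closed)
    have "d ((T ^^ m) x) ((T ^^ N) x) < \<epsilon>'" "d ((T ^^ N) x) ((T ^^ n) x) < \<epsilon>'"
      using N[of "m - N"] N[of "n - N"] that commute[OF X X] by auto
    then have "s * (d ((T ^^ m) x) ((T ^^ N) x) + d ((T ^^ N) x) ((T ^^ n) x)) < s * (\<epsilon>' + \<epsilon>')"
      using const_ge_one by (intro mult_strict_left_mono) auto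
    with relaxed_triangle[OF X X X, of m n N] \<epsilon>'(3) show ?thesis by linarith
  qed
  then show "\<exists>N. \<forall>m\<ge>N. \<forall>n\<ge>N. d ((T ^^ m) x) ((T ^^ n) x) < \<epsilon>" by blast
qed

text \<open>Smallness passes from \<open>d (u n) l\<close> to its \<open>G\<close>-value, then to
  the \<open>G\<close>-value of the image distance because \<open>\<phi> t < t\<close>, and back to
  that distance. Coinciding images are treated separately.\<close>

lemma GG2_continuous:
  assumes "G \<in> GG2" "range u \<subseteq> X" "l \<in> X" "b_converges d u l"
  shows "b_converges d (\<lambda>n. T (u n)) (T l)"
  unfolding b_converges_def
proof (rule order_tendstoI)
  have X: "u n \<in> X" "T (u n) \<in> X" "T l \<in> X" for n
    using assms(2,3) by (auto intro: T_closed)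
  fix \<epsilon> :: real assume "0 < \<epsilon>"
  then obtain \<delta> where \<delta>: "0 < \<delta>" "\<And>t. \<lbrakk>0 < t; G t < \<delta>\<rbrakk> \<Longrightarrow> t < \<epsilon>"
    using GG2_small_arguments[OF assms(1)] by metis
  obtain \<rho> where \<rho>: "0 < \<rho>" "\<And>t. \<lbrakk>0 < t; t < \<rho>\<rbrakk> \<Longrightarrow> G t < \<delta>"
    using GG2_small_values[OF assms(1) \<delta>(1)] by metis
  have "\<forall>\<^sub>F n in sequentially. d (u n) l < \<rho>"
    using assms(4) \<rho>(1) unfolding b_converges_def by (rule order_tendstoD)
  then show "\<forall>\<^sub>F n in sequentially. d (T (u n)) (T l) < \<epsilon>"
  proof eventually_elim
    case (elim n)
    show ?case
    proof (cases "T (u n) = T l")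
      case True
      then show ?thesis using X zero_iff[of "T l" "T l"] \<open>0 < \<epsilon>\<close> by simp
    next
      case False
      then have pos: "0 < d (u n) l" "0 < d (T (u n)) (T l)"
        using X assms(3) by (auto intro!: dist_pos)
      then have "G (d (T (u n)) (T l)) \<le> \<phi> (G (d (u n) l))"
        using X assms(3) by (intro contraction) auto
      also have "\<dots> < G (d (u n) l)"
        using pos by (simp add: Phi_less[OF phi] G_pos)
      also have "\<dots> < \<delta>"
        using pos elim by (intro \<rho>(2))
      finally show ?thesis
        using \<delta>(2) pos by blast
    qed
  qed
next
  have X: "T (u n) \<in> X" "T l \<in> X" for n
    using assms(2,3) by (auto intro: T_closed)
  fix a :: real assume "a < 0"
  then show "\<forall>\<^sub>F n in sequentially. a < d (T (u n)) (T l)"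
    using X by (intro always_eventually allI) (meson nonneg less_le_trans)
qed

lemma Picard_operator_GG2:
  assumes "G \<in> GG2" "X \<noteq> {}" "b_complete X d"
  shows "Picard_operator X d T"
proof -
  obtain x where x: "x \<in> X" using assms(2) by auto
  have orbit: "range (\<lambda>n. (T ^^ n) x) \<subseteq> X"
    using x by (auto intro: funpow_closed)
  then obtain l where l: "l \<in> X" "b_converges d (\<lambda>n. (T ^^ n) x) l"
    using assms(3) GG2_orbit_Cauchy[OF assms(1) x] unfolding b_complete_def by blast
  \<comment> \<open>The shifted orbit converges to \<open>T l\<close> by continuity of
    \<open>T\<close>, and to \<open>l\<close> as a tail of the orbit.\<close>
  have "T l = l"
  proof (rule limit_unique)
    show "range (\<lambda>n. T ((T ^^ n) x)) \<subseteq> X" "T l \<in> X" "l \<in> X"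
      using orbit l by (auto intro: T_closed)
    show "b_converges d (\<lambda>n. T ((T ^^ n) x)) (T l)"
      using assms(1) orbit l by (rule GG2_continuous)
    show "b_converges d (\<lambda>n. T ((T ^^ n) x)) l"
      using LIMSEQ_Suc[OF l(2)[unfolded b_converges_def]] by (simp add: b_converges_def)
  qed
  with l(1) show ?thesis
    by (rule Picard_operatorI) (rule GG2_asymptotic[OF assms(1)])
qed

end

theorem theorem3p1:
  fixes X :: "'a set" and d :: "'a \<Rightarrow> 'a \<Rightarrow> real" and s :: real and T :: "'a \<Rightarrow> 'a"
  assumes "b_metric_space X d s"
    and "X \<noteq> {}"
    and "b_complete X d"
    and "T \<in> X \<rightarrow> X"
    and "\<exists>G \<in> GG1 \<union> GG2. \<exists>\<phi> \<in> Phi. T \<in> TT X d G \<phi>"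
  shows "Picard_operator X d T"
proof -
  interpret b_metric_space X d s by (fact assms(1))
  obtain G \<phi> where G: "G \<in> GG1 \<union> GG2" and \<phi>: "\<phi> \<in> Phi" and T: "T \<in> TT X d G \<phi>"
    using assms(5) by blast
  interpret G_contraction X d s T G \<phi>
  proof
    show "0 < G t" if "0 < t" for t
      using G that by (auto simp: GG1_def GG2_def Pi_iff)
  qed (use assms(4) \<phi> T in \<open>auto simp: TT_def\<close>)
  from G show ?thesis
    using Picard_operator_GG1 Picard_operator_GG2 assms(2,3) by blast
qed

end
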